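(* Let $G$ be a graph on $n$ vertices with maximum degree $\Delta$, and let $L=\{1,\dots,l\}$ be the label set. If $|L|\ge(\Delta^2+1)n+\Delta\binom{n-1}{2}$, then Alice has a winning strategy in the ESD labeling game on $G$ with label set $L$.
   Context: For a graph $G=(V,E)$ and $l\in\mathbb N$, a vertex labeling $\phi:V\to\{1,\dots,l\}$ is an edge-sum distinguishing (ESD) labeling if $\phi$ is injective and the edge-weights $w_\phi(uv)=\phi(u)+\phi(v)$ are pairwise distinct over all edges $uv\in E$. ESD labeling game on $G$ with label set $L=\{1,\dots,l\}$: Alice and Bob alternate moves, Alice starting. In each move the player chooses a not-yet-labeled vertex and assigns to it a label from $L$ not used before; the move is legal if the edge-weights of edges with both endpoints labeled remain pairwise distinct. The game ends when no legal move is possible or an ESD labeling of $G$ is created; Alice wins if an ESD labeling is created, otherwise Bob wins. *)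

theory Defs
  imports Main
begin

definition simple_graph :: "'a set \<Rightarrow> 'a set set \<Rightarrow> bool" where
  "simple_graph V E \<longleftrightarrow> finite V \<and> (\<forall>e\<in>E. e \<subseteq> V \<and> card e = 2)"

definition degree :: "'a set set \<Rightarrow> 'a \<Rightarrow> nat" where
  "degree E v = card {e \<in> E. v \<in> e}"

text \<open>The inserted 0 only matters for the graph without vertices.\<close>

definition max_degree :: "'a set \<Rightarrow> 'a set set \<Rightarrow> nat" where
  "max_degree V E = Max (insert 0 (degree E ` V))"

text \<open>For an edge \<open>{u, v}\<close> with \<open>u \<noteq> v\<close> the weight is \<open>f u + f v\<close>.\<close>

definition edge_weight :: "('a \<Rightarrow> nat) \<Rightarrow> 'a set \<Rightarrow> nat" where
  "edge_weight f e = (\<Sum>v\<in>e. f v)"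

definition esd_labeling :: "'a set \<Rightarrow> 'a set set \<Rightarrow> nat \<Rightarrow> ('a \<Rightarrow> nat) \<Rightarrow> bool" where
  "esd_labeling V E l f \<longleftrightarrow>
     f ` V \<subseteq> {1..l} \<and> inj_on f V \<and> inj_on (edge_weight f) E"

text \<open>
  A position of the game is a partial labeling; its domain is the set of vertices labeled so far.
\<close>

definition labels_of :: "('a \<rightharpoonup> nat) \<Rightarrow> 'a \<Rightarrow> nat" where
  "labels_of \<phi> v = the (\<phi> v)"

definition legal_move ::
    "'a set \<Rightarrow> 'a set set \<Rightarrow> nat \<Rightarrow> ('a \<rightharpoonup> nat) \<Rightarrow> 'a \<times> nat \<Rightarrow> bool" where
  "legal_move V E l \<phi> m \<longleftrightarrow>
     (case m of (v, k) \<Rightarrow>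
        v \<in> V \<and> v \<notin> dom \<phi> \<and> k \<in> {1..l} \<and> k \<notin> ran \<phi> \<and>
        inj_on (edge_weight (labels_of (\<phi>(v \<mapsto> k)))) {e \<in> E. e \<subseteq> dom (\<phi>(v \<mapsto> k))})"

definition esd_created :: "'a set \<Rightarrow> 'a set set \<Rightarrow> nat \<Rightarrow> ('a \<rightharpoonup> nat) \<Rightarrow> bool" where
  "esd_created V E l \<phi> \<longleftrightarrow> dom \<phi> = V \<and> esd_labeling V E l (labels_of \<phi>)"

definition game_over :: "'a set \<Rightarrow> 'a set set \<Rightarrow> nat \<Rightarrow> ('a \<rightharpoonup> nat) \<Rightarrow> bool" where
  "game_over V E l \<phi> \<longleftrightarrow> (\<nexists>m. legal_move V E l \<phi> m) \<or> esd_created V E l \<phi>"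

text \<open>
  A (possibly unfinished) play is the list of its moves in chronological order. No vertex occurs
  twice in a play, so \<open>map_of\<close> yields the position reached.
\<close>

inductive play :: "'a set \<Rightarrow> 'a set set \<Rightarrow> nat \<Rightarrow> ('a \<times> nat) list \<Rightarrow> bool"
  for V E l where
  start: "play V E l []"
| move: "\<lbrakk>play V E l ms; \<not> game_over V E l (map_of ms); legal_move V E l (map_of ms) m\<rbrakk>
    \<Longrightarrow> play V E l (ms @ [m])"

text \<open>
  A strategy maps the history of moves to the next move. Alice starts, so it is her turn exactly
  after an even number of moves.
\<close>

definition alice_follows :: "(('a \<times> nat) list \<Rightarrow> 'a \<times> nat) \<Rightarrow> ('a \<times> nat) list \<Rightarrow> bool" where
  "alice_follows \<sigma> ms \<longleftrightarrow> (\<forall>i < length ms. even i \<longrightarrow> ms ! i = \<sigma> (take i ms))"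

text \<open>
  The first conjunct makes the strategy prescribe a legal move whenever Alice has to move. Since
  every move labels a new vertex of the finite set \<open>V\<close>, every play ends after finitely many
  moves, so no clause for infinite plays is needed.
\<close>

definition alice_winning_strategy ::
    "'a set \<Rightarrow> 'a set set \<Rightarrow> nat \<Rightarrow> (('a \<times> nat) list \<Rightarrow> 'a \<times> nat) \<Rightarrow> bool" where
  "alice_winning_strategy V E l \<sigma> \<longleftrightarrow>
     (\<forall>ms. play V E l ms \<and> alice_follows \<sigma> ms \<longrightarrow>
        (even (length ms) \<and> \<not> game_over V E l (map_of ms) \<longrightarrow>
           legal_move V E l (map_of ms) (\<sigma> ms)) \<and>
        (game_over V E l (map_of ms) \<longrightarrow> esd_created V E l (map_of ms)))"

end

theory Submission
  imports Defs
begin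

text \<open>
  Alice wins however she plays, because no position of the game is a dead end. If \<open>j < n\<close> vertices
  are labeled, at most \<open>\<Delta> j\<close> edges already have a weight. A label for a further vertex \<open>v\<close> is
  forbidden only if it is one of the \<open>j\<close> used labels, or if it gives one of the at most \<open>\<Delta>\<close>
  edges at \<open>v\<close> an already existing weight; two edges at \<open>v\<close> never collide, because the labels of
  their other endpoints differ. So at most \<open>j + \<Delta> \<cdot> \<Delta> j < (\<Delta>\<^sup>2 + 1) n\<close> labels are
  forbidden.
\<close>

text \<open>The invariant of the game: on \<open>dom \<phi>\<close> the labels form an ESD labeling
  of the induced subgraph. Only edges inside \<open>dom \<phi>\<close> are compared, because
  \<open>labels_of\<close> has the unspecified value \<open>the None\<close> at an unlabeled
  vertex.\<close>

definition valid_position :: "'a set \<Rightarrow> 'a set set \<Rightarrow> nat \<Rightarrow> ('a \<rightharpoonup> nat) \<Rightarrow> bool" where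
  "valid_position V E l \<phi> \<longleftrightarrow>
     dom \<phi> \<subseteq> V \<and> ran \<phi> \<subseteq> {1..l} \<and> inj_on (labels_of \<phi>) (dom \<phi>) \<and>
     inj_on (edge_weight (labels_of \<phi>)) {e \<in> E. e \<subseteq> dom \<phi>}"

lemma ran_eq_labels_of_image: "ran \<phi> = labels_of \<phi> ` dom \<phi>"
  by (force simp: labels_of_def ran_def dom_def image_iff)

lemma labels_of_upd: "labels_of (\<phi>(v \<mapsto> k)) = (labels_of \<phi>)(v := k)"
  by (auto simp: labels_of_def)

lemma valid_position_legal_move:
  assumes "valid_position V E l \<phi>" and "legal_move V E l \<phi> (v, k)"
  shows "valid_position V E l (\<phi>(v \<mapsto> k))"
proof -
  have v: "v \<in> V" "v \<notin> dom \<phi>" and k: "k \<in> {1..l}" "k \<notin> labels_of \<phi> ` dom \<phi>"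
    and w: "inj_on (edge_weight (labels_of (\<phi>(v \<mapsto> k)))) {e \<in> E. e \<subseteq> dom (\<phi>(v \<mapsto> k))}"
    using assms(2) by (auto simp: legal_move_def ran_eq_labels_of_image[symmetric])
  have \<phi>: "dom \<phi> \<subseteq> V" "ran \<phi> \<subseteq> {1..l}" "inj_on (labels_of \<phi>) (dom \<phi>)"
    using assms(1) by (auto simp: valid_position_def)
  have "inj_on (labels_of (\<phi>(v \<mapsto> k))) (dom (\<phi>(v \<mapsto> k)))"
    using \<phi>(3) v(2) k(2) unfolding labels_of_upd by (auto simp: inj_on_def image_iff)
  moreover have "ran (\<phi>(v \<mapsto> k)) \<subseteq> {1..l}"
    using \<phi>(2) k(1) v(2) by (auto simp: ran_def split: if_splits)
  ultimately show ?thesis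
    using \<phi>(1) v(1) w by (simp add: valid_position_def)
qed

lemma play_valid_position:
  assumes "play V E l ms"
  shows "valid_position V E l (map_of ms)"
  using assms
proof induction
  case start
  show ?case by (simp add: valid_position_def inj_on_def)
next
  case (move ms m)
  obtain v k where m: "m = (v, k)" by fastforce
  \<comment> \<open>In \<open>map_of (ms @ [m])\<close> an earlier entry for the same vertex would
    take precedence over \<open>m\<close>; freshness of \<open>v\<close> is what turns the appended
    move into a map update.\<close>
  have "v \<notin> dom (map_of ms)"
    using move.hyps(3) by (simp add: legal_move_def m)
  then have "map_of (ms @ [m]) = (map_of ms)(v \<mapsto> k)"
    by (auto simp: m map_add_def fun_eq_iff split: option.split)
  then show ?case
    using valid_position_legal_move move.IH move.hyps(3) m by metis
qed

lemma valid_position_full: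
  assumes "valid_position V E l \<phi>" and "dom \<phi> = V" and "simple_graph V E"
  shows "esd_created V E l \<phi>"
proof -
  have "{e \<in> E. e \<subseteq> V} = E"
    using assms(3) by (auto simp: simple_graph_def)
  then show ?thesis
    using assms(1,2) by (simp add: valid_position_def esd_created_def esd_labeling_def
        ran_eq_labels_of_image)
qed

lemma simple_graph_finite_edges:
  assumes "simple_graph V E"
  shows "finite E"
proof (rule finite_subset)
  show "E \<subseteq> Pow V" "finite (Pow V)"
    using assms by (auto simp: simple_graph_def)
qed

lemma degree_le_max_degree:
  assumes "finite V" and "v \<in> V"
  shows "degree E v \<le> max_degree V E"
  using assms by (simp add: max_degree_def)

text \<open>An edge is nonempty, so each edge inside \<open>D\<close> is counted in the degree of
  some vertex of \<open>D\<close>. Counting it at both endpoints only enlarges the bound.\<close>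

lemma card_edges_within_le:
  assumes "simple_graph V E" and "D \<subseteq> V"
  shows "card {e \<in> E. e \<subseteq> D} \<le> card D * max_degree V E"
proof -
  have V: "finite V" and D: "finite D"
    using assms by (auto simp: simple_graph_def intro: finite_subset)
  have "{e \<in> E. e \<subseteq> D} \<subseteq> (\<Union>v\<in>D. {e \<in> E. v \<in> e})"
  proof
    fix e assume e: "e \<in> {e \<in> E. e \<subseteq> D}"
    then have "e \<noteq> {}"
      using assms(1) by (auto simp: simple_graph_def)
    with e show "e \<in> (\<Union>v\<in>D. {e \<in> E. v \<in> e})" by auto
  qed
  then have "card {e \<in> E. e \<subseteq> D} \<le> card (\<Union>v\<in>D. {e \<in> E. v \<in> e})"
    using D simple_graph_finite_edges[OF assms(1)] by (intro card_mono) auto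
  also have "\<dots> \<le> (\<Sum>v\<in>D. degree E v)"
    unfolding degree_def by (rule card_UN_le[OF D])
  also have "\<dots> \<le> card D * max_degree V E"
    using sum_bounded_above[of D "degree E" "max_degree V E"] degree_le_max_degree[OF V] assms(2)
    by auto
  finally show ?thesis .
qed

lemma edge_weight_upd_notin:
  assumes "v \<notin> e"
  shows "edge_weight (f(v := k)) e = edge_weight f e"
  unfolding edge_weight_def using assms by (intro sum.cong) auto

text \<open>Isolates the new label: for an edge at \<open>v\<close>, the remaining term is the old
  label of the other endpoint.\<close>

lemma edge_weight_upd_in:
  assumes "finite e" and "v \<in> e"
  shows "edge_weight (f(v := k)) e = k + edge_weight f (e - {v})"
  using edge_weight_upd_notin[of v "e - {v}" f k]
  by (simp add: edge_weight_def sum.remove[OF assms])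

lemma ex_legal_label:
  assumes G: "simple_graph V E" and \<phi>: "valid_position V E l \<phi>"
    and v: "v \<in> V" "v \<notin> dom \<phi>"
    and l: "((max_degree V E)\<^sup>2 + 1) * card V \<le> l"
  shows "\<exists>k. legal_move V E l \<phi> (v, k)"
proof -
  define f where "f = labels_of \<phi>"
  define \<Delta> where "\<Delta> = max_degree V E"
  define N where "N = {e \<in> E. v \<in> e}"
  define M where "M = {e \<in> E. e \<subseteq> dom \<phi>}"
  define F where
    "F = f ` dom \<phi> \<union> (\<lambda>(d, e). edge_weight f e - edge_weight f (d - {v})) ` (N \<times> M)"
  have edge: "card e = 2" "finite e" if "e \<in> E" for e
    using G that by (auto simp: simple_graph_def intro: finite_subset)
  have V: "finite V" using G by (simp add: simple_graph_def)
  have D: "dom \<phi> \<subseteq> V" and inj: "inj_on f (dom \<phi>)" and injM: "inj_on (edge_weight f) M"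
    using \<phi> by (auto simp: valid_position_def f_def M_def)
  have finD: "finite (dom \<phi>)" using D V by (rule finite_subset)
  have finNM: "finite (N \<times> M)"
    using simple_graph_finite_edges[OF G] by (simp add: N_def M_def)
  have "card F \<le> card (dom \<phi>) + card (N \<times> M)"
    unfolding F_def
    by (intro order.trans[OF card_Un_le] add_mono card_image_le finD finNM)
  also have "\<dots> \<le> card (dom \<phi>) + \<Delta> * (card (dom \<phi>) * \<Delta>)"
    using degree_le_max_degree[OF V v(1), of E] card_edges_within_le[OF G D]
    by (simp add: card_cartesian_product \<Delta>_def N_def M_def degree_def mult_le_mono)
  also have "\<dots> = (\<Delta>\<^sup>2 + 1) * card (dom \<phi>)"
    by (simp add: power2_eq_square)
  also have "\<dots> < (\<Delta>\<^sup>2 + 1) * card V"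
  proof -
    have "dom \<phi> \<subset> V" using D v by blast
    then have "card (dom \<phi>) < card V" by (rule psubset_card_mono[OF V])
    then show ?thesis by (intro mult_strict_left_mono) auto
  qed
  also have "\<dots> \<le> card {1..l}" using l by (simp add: \<Delta>_def)
  finally have "\<not> {1..l} \<subseteq> F"
    using card_mono[of F "{1..l}"] finD finNM by (auto simp: F_def)
  then obtain k where k: "k \<in> {1..l}" "k \<notin> F" by blast
  define g where "g = f(v := k)"
  have old: "e \<in> M" "edge_weight g e = edge_weight f e"
    if "e \<in> E" "e \<subseteq> insert v (dom \<phi>)" "v \<notin> e" for e
    using that by (auto simp: M_def g_def edge_weight_upd_notin)
  have new: "edge_weight g d = k + edge_weight f (d - {v})" if "d \<in> E" "v \<in> d" for d
    using edge_weight_upd_in edge(2) that by (metis g_def)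
  have mixed: "edge_weight g d \<noteq> edge_weight g e"
    if "d \<in> E" "v \<in> d" "e \<in> E" "e \<subseteq> insert v (dom \<phi>)" "v \<notin> e" for d e
  proof
    assume "edge_weight g d = edge_weight g e"
    then have "k = edge_weight f e - edge_weight f (d - {v})"
      using new old(2) that by simp
    moreover have "(d, e) \<in> N \<times> M"
      using old(1) that by (simp add: N_def)
    ultimately show False using k(2) by (force simp: F_def)
  qed
  have both_new: "d = e"
    if de: "d \<in> E" "v \<in> d" "d \<subseteq> insert v (dom \<phi>)" "e \<in> E" "v \<in> e" "e \<subseteq> insert v (dom \<phi>)"
      "edge_weight g d = edge_weight g e" for d e
  proof -
    \<comment> \<open>Naming the other endpoints lets the common summand \<open>k\<close> cancel, so
      the collision becomes an equality of two old labels.\<close>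
    have other: "\<exists>u. c = {v, u} \<and> u \<noteq> v" if "c \<in> E" "v \<in> c" for c
      using edge(1)[OF that(1)] that(2) by (auto simp: card_2_iff)
    obtain x where x: "d = {v, x}" "x \<noteq> v" using other de by blast
    obtain y where y: "e = {v, y}" "y \<noteq> v" using other de by blast
    have "f x = f y"
      using de(7) x y by (simp add: edge_weight_def g_def)
    moreover have "x \<in> dom \<phi>" "y \<in> dom \<phi>" using de x y by auto
    ultimately show ?thesis using inj x y by (auto dest: inj_onD)
  qed
  have "inj_on (edge_weight g) {e \<in> E. e \<subseteq> insert v (dom \<phi>)}"
  proof (rule inj_onI)
    fix d e
    assume d: "d \<in> {e \<in> E. e \<subseteq> insert v (dom \<phi>)}" and e: "e \<in> {e \<in> E. e \<subseteq> insert v (dom \<phi>)}"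
      and eq: "edge_weight g d = edge_weight g e"
    consider "v \<in> d" "v \<in> e" | "v \<in> d" "v \<notin> e" | "v \<notin> d" "v \<in> e" | "v \<notin> d" "v \<notin> e" by blast
    then show "d = e"
    proof cases
      case 1 then show ?thesis using both_new d e eq by blast
    next
      case 2 then show ?thesis using mixed d e eq by blast
    next
      case 3 then show ?thesis using mixed[of e d] d e eq by auto
    next
      case 4 then show ?thesis using old d e eq injM by (auto dest: inj_onD)
    qed
  qed
  moreover have "k \<notin> ran \<phi>"
    using k(2) by (auto simp: F_def f_def ran_eq_labels_of_image)
  ultimately show ?thesis
    using v k(1) by (auto simp: legal_move_def labels_of_upd g_def f_def)
qed

theorem theorem13:
  fixes V :: "'a set" and E :: "'a set set" and n \<Delta> l :: nat
  assumes "simple_graph V E"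
    and "n = card V"
    and "\<Delta> = max_degree V E"
    and "card {1..l} \<ge> (\<Delta>^2 + 1) * n + \<Delta> * ((n - 1) choose 2)"
  shows "\<exists>\<sigma>. alice_winning_strategy V E l \<sigma>"
proof -
  \<comment> \<open>An arbitrary legal move suffices. The choice is unspecified only where no legal
    move exists, and there the game is over.\<close>
  define \<sigma> where "\<sigma> ms = (SOME m. legal_move V E l (map_of ms) m)" for ms
  have l: "((max_degree V E)\<^sup>2 + 1) * card V \<le> l"
    using assms by simp
  have "legal_move V E l (map_of ms) (\<sigma> ms)" if "\<not> game_over V E l (map_of ms)" for ms
    using that unfolding \<sigma>_def game_over_def by (auto intro: someI)
  moreover have "esd_created V E l (map_of ms)"
    if "play V E l ms" and over: "game_over V E l (map_of ms)" for ms
  proof (rule ccontr)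
    \<comment> \<open>The game could then be over only for lack of a legal move, but the invariant
      leaves some vertex unlabeled and a label for it exists.\<close>
    assume "\<not> esd_created V E l (map_of ms)"
    moreover have pos: "valid_position V E l (map_of ms)"
      using play_valid_position that(1) .
    ultimately have "dom (map_of ms) \<noteq> V"
      using valid_position_full assms(1) by blast
    then obtain v where "v \<in> V" "v \<notin> dom (map_of ms)"
      using pos by (auto simp: valid_position_def)
    then have "\<exists>m. legal_move V E l (map_of ms) m"
      using ex_legal_label[OF assms(1) pos _ _ l] by blast
    with over \<open>\<not> esd_created V E l (map_of ms)\<close> show False
      by (simp add: game_over_def)
  qed
  ultimately show ?thesis
    unfolding alice_winning_strategy_def by blast
qed

end
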